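(* For any $\alpha\in\mathbb{R}$ there exists a rooted tree $T$ such that $\mu(T)>\alpha\,\rho(T)$.
   Context: A rooted tree $T$ is a finite tree with a distinguished vertex $r$, its root. The bottleneck matrix of $T$ is the matrix $M=[m_{ij}]$ indexed by $V(T)$, where $m_{ij}$ is the number of vertices lying both on the path joining $i$ to $r$ and on the path joining $j$ to $r$ (paths include their endpoints). The Perron value $\rho(T)$ is the spectral radius (largest eigenvalue) of $M$. The moment of $T$ is $\mu(T)=\sum_{v\in V(T)}\operatorname{dist}(v,r)\deg(v)$, where $\operatorname{dist}(v,r)$ is the number of edges in the path joining $v$ to $r$ and $\deg(v)$ is the degree of $v$ in $T$. *)

theory Defs
  imports
    Graph_Theory.Digraph_Component
    Jordan_Normal_Form.Spectral_Radius
begin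

(* A finite simple graph is a symmetric loop-free finite digraph (pair_graph), every edge being
   a pair of opposite arcs.  The library's predicate tree cannot be used for such graphs: it
   counts the two opposite arcs of an edge as a directed cycle of length 2.  The directed cycles
   of length at least 3 are precisely the traversals of the cycles of the undirected graph. *)

definition undirected_tree :: "'a pair_pre_digraph \<Rightarrow> bool" where
  "undirected_tree T \<longleftrightarrow>
     pair_graph T \<and> Digraph_Component.connected (with_proj T) \<and>
     \<not> (\<exists>p. pre_digraph.cycle (with_proj T) p \<and> 3 \<le> length p)"

definition rooted_tree :: "'a pair_pre_digraph \<Rightarrow> 'a \<Rightarrow> bool" where
  "rooted_tree T r \<longleftrightarrow> undirected_tree T \<and> r \<in> pverts T"

(* Paths are lists of arcs. *)

definition tree_path :: "'a pair_pre_digraph \<Rightarrow> 'a \<Rightarrow> 'a \<Rightarrow> ('a \<times> 'a) list" where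
  "tree_path T u v = (THE p. pre_digraph.apath (with_proj T) u p v)"

definition path_vertices :: "'a pair_pre_digraph \<Rightarrow> 'a \<Rightarrow> 'a \<Rightarrow> 'a set" where
  "path_vertices T u v = set (pre_digraph.awalk_verts (with_proj T) u (tree_path T u v))"

definition tree_dist :: "'a pair_pre_digraph \<Rightarrow> 'a \<Rightarrow> 'a \<Rightarrow> nat" where
  "tree_dist T u v = length (tree_path T u v)"

definition bottleneck_entry :: "'a pair_pre_digraph \<Rightarrow> 'a \<Rightarrow> 'a \<Rightarrow> 'a \<Rightarrow> nat" where
  "bottleneck_entry T r i j = card (path_vertices T i r \<inter> path_vertices T j r)"

(* Matrices are indexed by initial segments of the naturals, so V(T) is listed in increasing
   order; the spectrum does not depend on the order chosen. *)

definition bottleneck_matrix :: "'a::linorder pair_pre_digraph \<Rightarrow> 'a \<Rightarrow> real mat" where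
  "bottleneck_matrix T r =
     (let vs = sorted_list_of_set (pverts T); n = card (pverts T)
      in mat n n (\<lambda>(i, j). real (bottleneck_entry T r (vs ! i) (vs ! j))))"

definition perron_value :: "'a::linorder pair_pre_digraph \<Rightarrow> 'a \<Rightarrow> real" where
  "perron_value T r = spectral_radius (map_mat complex_of_real (bottleneck_matrix T r))"

(* In the symmetric digraph T, deg(v) is the number of arcs leaving v. *)

definition moment :: "'a pair_pre_digraph \<Rightarrow> 'a \<Rightarrow> nat" where
  "moment T r = (\<Sum>v\<in>pverts T. tree_dist T v r * out_degree (with_proj T) v)"

end

theory Submission
  imports Defs
begin

text \<open>
  The trees are spiders: \<open>L\<close> legs, each a path with \<open>L\<close> edges, glued together at the root.
  Since every vertex other than the root has positive degree, the moment is at least the sum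
  of all distances to the root, which is of order \<open>L\<^sup>3\<close>: there are about \<open>L\<^sup>2\<close> vertices, at
  average distance \<open>L / 2\<close>.

  The Perron value, on the other hand, is only of order \<open>L\<^sup>2\<close>.  Like every eigenvalue it is
  bounded by the largest absolute row sum of the matrix.  In the row of a vertex \<open>i\<close> other
  than the root (the row of the root consists of ones), a vertex on another leg contributes \<open>1\<close>,
  because only the root is common to the two paths; there are fewer than \<open>L\<^sup>2\<close> of these.  The vertices on the leg of \<open>i\<close>, together with the root, number
  \<open>L + 1\<close> and contribute at most \<open>L + 1\<close> each.  Hence the row sum is at most \<open>4 L\<^sup>2\<close>
  (\<open>perron_value_le\<close>) while the moment exceeds \<open>L\<^sup>3 / 2\<close> (\<open>moment_gt\<close>), and the ratio exceeds
  \<open>L / 8\<close>.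

  To compute paths, a tree is described by a parent function on an initial segment of the
  naturals that makes every vertex larger than its parent.  A path without repeated vertices
  cannot turn back towards the root once it has moved away from it; this excludes cycles and
  forces the path from a vertex to the root to follow the parents.
\<close>

section \<open>Trees given by a parent function\<close>

locale parent_tree =
  fixes parent :: "nat \<Rightarrow> nat" and n :: nat
  assumes parent_less: "0 < v \<Longrightarrow> parent v < v"
begin

definition T :: "nat pair_pre_digraph" where
  "T = \<lparr> pverts = {0..n},
         parcs = {(u, v). u \<le> n \<and> v \<le> n \<and> (0 < u \<and> v = parent u \<or> 0 < v \<and> u = parent v)} \<rparr>"

lemma pverts_T [simp]: "pverts T = {0..n}"
  by (simp add: T_def)

lemma mem_parcs_T:
  "(u, v) \<in> parcs T \<longleftrightarrow>
     u \<le> n \<and> v \<le> n \<and> (0 < u \<and> v = parent u \<or> 0 < v \<and> u = parent v)"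
  by (simp add: T_def)

sublocale tree: pair_graph T
proof
  show "finite (parcs T)"
    by (rule finite_subset[of _ "{0..n} \<times> {0..n}"]) (auto simp: mem_parcs_T)
  show "symmetric (with_proj T)"
    by (auto simp: symmetric_def sym_def mem_parcs_T)
  show "fst e \<noteq> snd e" if "e \<in> parcs T" for e
    using that parent_less by (cases e) (auto simp: mem_parcs_T dest!: parent_less)
qed (auto simp: mem_parcs_T)

lemma arc_cases:
  assumes "(u, v) \<in> parcs T"
  obtains (down) "0 < u" "v = parent u" "v < u"
        | (up) "0 < v" "u = parent v" "u < v"
  using assms parent_less by (auto simp: mem_parcs_T)

text \<open>
  In what follows, ``up'' means away from the root.  The only neighbour of a vertex that
  lies below it is its parent, so a path that has just gone up from a parent to its child could
  go down only by returning to that parent, which it has already visited.  Hence it keeps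
  rising.
\<close>

lemma apath_no_backtrack:
  assumes q: "tree.apath c q b" "q \<noteq> []" and a: "a \<notin> set (pawalk_verts c q)"
  shows "hd q \<noteq> (c, a)"
proof
  assume "hd q = (c, a)"
  with q obtain q' where "q = (c, a) # q'" "tree.apath a q' b"
    by (cases q) (auto simp: tree.apath_Cons_iff)
  with a show False using tree.hd_in_awalk_verts(2)[of a q' b] by simp
qed

lemma apath_starts_down_or_ends_above:
  assumes "tree.apath a q b" and "q \<noteq> []"
  shows "hd q = (a, parent a) \<and> 0 < a \<or> a < b"
  using assms
proof (induction q arbitrary: a)
  case (Cons e q)
  then obtain c where e: "e = (a, c)" "(a, c) \<in> parcs T"
    and q: "tree.apath c q b" and a: "a \<notin> set (pawalk_verts c q)"
    by (cases e) (auto simp: tree.apath_Cons_iff)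
  from e(2) show ?case
  proof (cases rule: arc_cases)
    case up
    show ?thesis
    proof (cases q)
      case Nil
      then show ?thesis using q up by (simp add: tree.apath_Nil_iff)
    next
      case (Cons f q')
      have "hd q \<noteq> (c, a)"
        using apath_no_backtrack[OF q _ a] Cons by simp
      with Cons.IH[OF q] up Cons show ?thesis by auto
    qed
  qed (simp add: e)
qed simp

text \<open>
  The mirror image: a path whose last step goes down cannot have gone up before.
\<close>

lemma apath_ends_up_or_ends_below:
  assumes "tree.apath a q b" and "q \<noteq> []"
  shows "last q = (parent b, b) \<or> b < a"
  using assms
proof (induction q arbitrary: a)
  case (Cons e q)
  then obtain c where e: "e = (a, c)" "(a, c) \<in> parcs T"
    and q: "tree.apath c q b" and a: "a \<notin> set (pawalk_verts c q)"
    by (cases e) (auto simp: tree.apath_Cons_iff)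
  show ?case
  proof (cases "q = []")
    case True
    then show ?thesis using q e(2) by (auto simp: tree.apath_Nil_iff e(1) elim: arc_cases)
  next
    case False
    from e(2) show ?thesis
    proof (cases rule: arc_cases)
      case down
      then show ?thesis using Cons.IH[OF q False] False by auto
    next
      case up
      have "hd q \<noteq> (c, a)"
        by (rule apath_no_backtrack[OF q False a])
      with apath_starts_down_or_ends_above[OF q False] up have "c < b" by auto
      with Cons.IH[OF q False] False show ?thesis by auto
    qed
  qed
qed simp

text \<open>
  No vertex lies below the root \<open>0\<close>, so a path that ends there must start with a step down.
\<close>

lemma apath_to_root_unfold:
  assumes "tree.apath v q 0"
  shows "q = (if v = 0 then [] else (v, parent v) # tl q)"
    and "0 < v \<Longrightarrow> tree.apath (parent v) (tl q) 0"
proof -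
  show 1: "q = (if v = 0 then [] else (v, parent v) # tl q)"
    using assms apath_starts_down_or_ends_above[OF assms]
    by (cases q) (auto simp: tree.apath_Nil_iff)
  show "tree.apath (parent v) (tl q) 0" if "0 < v"
    using assms 1 that by (metis less_irrefl snd_conv tree.apath_Cons_iff)
qed

text \<open>
  Following the parents gives a path; the bound on its vertices is what keeps them distinct
  in the induction.
\<close>

lemma apath_to_root_exists:
  "v \<le> n \<Longrightarrow> \<exists>q. tree.apath v q 0 \<and> (\<forall>w \<in> set (pawalk_verts v q). w \<le> v)"
proof (induction v rule: less_induct)
  case (less v)
  show ?case
  proof (cases "v = 0")
    case True
    then show ?thesis by (intro exI[of _ "[]"]) (auto simp: tree.apath_Nil_iff)
  next
    case False
    then have "parent v < v" by (simp add: parent_less)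
    with less obtain q where q: "tree.apath (parent v) q 0"
      "\<forall>w \<in> set (pawalk_verts (parent v) q). w \<le> parent v"
      by (meson le_trans less_imp_le)
    with False \<open>parent v < v\<close> less.prems show ?thesis
      by (intro exI[of _ "(v, parent v) # q"])
        (auto simp: tree.apath_Cons_iff mem_parcs_T)
  qed
qed

lemma ex1_apath_to_root:
  assumes "v \<le> n" shows "\<exists>!q. tree.apath v q 0"
proof (rule ex_ex1I)
  show "\<exists>q. tree.apath v q 0" using apath_to_root_exists[OF assms] by blast
  show "q = q'" if "tree.apath v q 0" "tree.apath v q' 0" for q q'
    using that
  proof (induction v arbitrary: q q' rule: less_induct)
    case (less v)
    show ?case
    proof (cases "v = 0")
      case False
      with less.IH[of "parent v" "tl q" "tl q'"] less.prems have "tl q = tl q'"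
        by (simp add: parent_less apath_to_root_unfold(2))
      with False less.prems apath_to_root_unfold(1)[of v] show ?thesis by metis
    next
      case True
      with less.prems apath_to_root_unfold(1)[of v] show ?thesis by metis
    qed
  qed
qed

lemma apath_tree_path:
  assumes "v \<le> n" shows "tree.apath v (tree_path T v 0) 0"
  using theI'[OF ex1_apath_to_root[OF assms]] by (simp add: tree_path_def)

lemma tree_path_root [simp]: "tree_path T 0 0 = []"
  using apath_to_root_unfold(1)[OF apath_tree_path[of 0]] by simp

lemma tree_path_step:
  assumes "0 < v" "v \<le> n"
  shows "tree_path T v 0 = (v, parent v) # tree_path T (parent v) 0"
proof -
  note path = apath_tree_path[OF assms(2)]
  have "parent v \<le> n" using assms parent_less[of v] by simp
  then have "tl (tree_path T v 0) = tree_path T (parent v) 0"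
    using apath_to_root_unfold(2)[OF path assms(1)]
      apath_tree_path[of "parent v"] ex1_apath_to_root[of "parent v"] by blast
  then show ?thesis using apath_to_root_unfold(1)[OF path] assms(1) by simp
qed

lemma tree_dist_root [simp]: "tree_dist T 0 0 = 0"
  by (simp add: tree_dist_def)

lemma tree_dist_step:
  "0 < v \<Longrightarrow> v \<le> n \<Longrightarrow> tree_dist T v 0 = Suc (tree_dist T (parent v) 0)"
  by (simp add: tree_dist_def tree_path_step)

lemma path_vertices_root [simp]: "path_vertices T 0 0 = {0}"
  by (simp add: path_vertices_def)

lemma path_vertices_step:
  "0 < v \<Longrightarrow> v \<le> n \<Longrightarrow> path_vertices T v 0 = insert v (path_vertices T (parent v) 0)"
  by (simp add: path_vertices_def tree_path_step)

lemma card_path_vertices_le: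
  "v \<le> n \<Longrightarrow> card (path_vertices T v 0) \<le> Suc (tree_dist T v 0)"
  unfolding path_vertices_def tree_dist_def
  by (metis awalk_verts_with_proj_eq card_length tree.length_awalk_verts)

text \<open>
  Remove the first arc \<open>(u, w)\<close> from a cycle.  What is left is a path from \<open>w\<close> back to its
  neighbour \<open>u\<close>.  If \<open>w\<close> is the parent of \<open>u\<close>, this path ends above its start, so its last arc
  goes up and is \<open>(w, u)\<close>; if \<open>u\<close> is the parent of \<open>w\<close>, the path ends below its start, so its
  first arc goes down and is \<open>(w, u)\<close>.  A path from \<open>w\<close> to \<open>u\<close> with a second arc cannot
  contain \<open>(w, u)\<close>, since it would visit \<open>w\<close> or \<open>u\<close> twice.
\<close>

lemma no_long_cycle:
  assumes "tree.cycle q"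
  shows "length q < 3"
proof (rule ccontr)
  assume len: "\<not> length q < 3"
  from assms obtain u where u: "tree.awalk u q u" "distinct (tl (pawalk_verts u q))"
    by (auto simp: tree.cycle_def)
  with len obtain w s where q: "q = (u, w) # s" and len: "2 \<le> length s"
    by (cases q) (auto simp: tree.awalk_Cons_iff)
  with u have e: "(u, w) \<in> parcs T" and s: "tree.apath w s u"
    by (auto simp: tree.awalk_Cons_iff tree.apath_def)
  from len have "s \<noteq> []" by auto
  from len obtain f g s' where s_eq: "s = f # g # s'"
    by (cases s; cases "tl s") auto
  from e show False
  proof (cases rule: arc_cases)
    case down
    with apath_ends_up_or_ends_below[OF s \<open>s \<noteq> []\<close>] have "last (g # s') = (w, u)"
      by (simp add: s_eq)
    then have "w \<in> set (pawalk_verts (snd f) (g # s'))"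
      using s unfolding s_eq tree.apath_Cons_iff
      by (metis fst_conv in_set_conv_nth last_in_set list.distinct(1) tree.awalk_verts_conv
          Un_iff image_eqI list.set_map set_append)
    with s show False by (auto simp: s_eq tree.apath_Cons_iff)
  next
    case up
    with apath_starts_down_or_ends_above[OF s \<open>s \<noteq> []\<close>] have "f = (w, u)"
      by (simp add: s_eq)
    with s show False
      using tree.apath_nonempty_ends[of u "g # s'" u]
      by (auto simp: s_eq tree.apath_Cons_iff)
  qed
qed

lemma rooted_tree_T: "rooted_tree T 0"
proof -
  have reach: "v \<rightarrow>\<^sup>*\<^bsub>with_proj T\<^esub> 0" if "v \<le> n" for v
    using apath_tree_path[OF that] by (auto simp: tree.reachable_awalk tree.apath_def)
  have "u \<rightarrow>\<^sup>*\<^bsub>with_proj T\<^esub> v" if "u \<le> n" "v \<le> n" for u v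
    using reach[OF that(1)] symmetric_reachable[OF tree.sym_arcs reach[OF that(2)]]
    by (rule tree.reachable_trans)
  then have "Digraph_Component.connected (with_proj T)"
    unfolding Digraph_Component.connected_def
    by (intro strongly_connectedI) (auto intro: tree.reachable_mk_symmetricI)
  moreover have "\<not> (\<exists>q. tree.cycle q \<and> 3 \<le> length q)"
    using no_long_cycle by fastforce
  ultimately show ?thesis
    by (simp add: rooted_tree_def undirected_tree_def tree.pair_graph)
qed

lemma sum_tree_dist_le_moment: "(\<Sum>v\<in>{0..n}. tree_dist T v 0) \<le> moment T 0"
  unfolding moment_def pverts_T
proof (rule sum_mono)
  fix v assume v: "v \<in> {0..n}"
  show "tree_dist T v 0 \<le> tree_dist T v 0 * out_degree (with_proj T) v"
  proof (cases "v = 0")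
    case False
    with v have "(v, parent v) \<in> out_arcs (with_proj T) v"
      using parent_less[of v] by (auto simp: out_arcs_def mem_parcs_T)
    then have "0 < out_degree (with_proj T) v"
      unfolding out_degree_def using tree.finite_out_arcs card_gt_0_iff by blast
    then show ?thesis by simp
  qed simp
qed

end

section \<open>The Perron value and row sums\<close>

text \<open>
  Compare the two sides of the eigenvector equation in a coordinate where the eigenvector has
  the largest absolute value.
\<close>

lemma spectral_radius_le_row_sum:
  assumes A: "A \<in> carrier_mat n n" and n: "0 < n"
    and rows: "\<And>i. i < n \<Longrightarrow> (\<Sum>j<n. cmod (A $$ (i, j))) \<le> B"
  shows "spectral_radius A \<le> B"
proof -
  obtain k where k: "eigenvalue A k" and sr: "spectral_radius A = cmod k"
    using spectral_radius_mem_max(1)[OF A n] by (auto simp: spectrum_def)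
  obtain x where x: "x \<in> carrier_vec n" "x \<noteq> 0\<^sub>v n" "A *\<^sub>v x = k \<cdot>\<^sub>v x"
    using k A by (auto simp: eigenvalue_def eigenvector_def)
  obtain i where i: "i < n" and max: "\<And>j. j < n \<Longrightarrow> cmod (x $ j) \<le> cmod (x $ i)"
  proof -
    let ?M = "Max ((\<lambda>j. cmod (x $ j)) ` {..<n})"
    have "?M \<in> (\<lambda>j. cmod (x $ j)) ` {..<n}"
      using n by (intro Max_in) auto
    then obtain i where "i < n" "cmod (x $ i) = ?M" by auto
    moreover have "cmod (x $ j) \<le> ?M" if "j < n" for j
      using that by (intro Max_ge) auto
    ultimately show ?thesis using that by auto
  qed
  have pos: "0 < cmod (x $ i)"
  proof (rule ccontr)
    assume "\<not> 0 < cmod (x $ i)"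
    with max have "x $ j = 0" if "j < n" for j
      using that by force
    with x(1,2) show False by (auto intro!: eq_vecI)
  qed
  have "cmod k * cmod (x $ i) = cmod ((A *\<^sub>v x) $ i)"
    using x i by (simp add: norm_mult)
  also have "\<dots> = cmod (\<Sum>j<n. A $$ (i, j) * x $ j)"
    using A x(1) i by (simp add: scalar_prod_def atLeast0LessThan)
  also have "\<dots> \<le> (\<Sum>j<n. cmod (A $$ (i, j)) * cmod (x $ i))"
    by (rule order_trans[OF norm_sum]) (auto simp: norm_mult intro!: sum_mono mult_left_mono max)
  also have "\<dots> \<le> B * cmod (x $ i)"
    unfolding sum_distrib_right[symmetric] by (intro mult_right_mono rows i) simp
  finally show ?thesis using pos by (simp add: sr)
qed

context parent_tree
begin

lemma bottleneck_matrix_T: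
  "bottleneck_matrix T 0 =
     mat (Suc n) (Suc n) (\<lambda>(i, j). real (bottleneck_entry T 0 i j))"
proof -
  have vs: "sorted_list_of_set {0..n} = [0..<Suc n]"
    by (metis atLeastLessThanSuc_atLeastAtMost sorted_list_of_set_range)
  show ?thesis
    unfolding bottleneck_matrix_def pverts_T Let_def vs
    by (intro eq_matI) (auto simp del: upt_Suc simp: nth_upt)
qed

lemma perron_value_T_le:
  assumes "\<And>i. i \<le> n \<Longrightarrow> (\<Sum>j\<le>n. bottleneck_entry T 0 i j) \<le> B"
  shows "perron_value T 0 \<le> real B"
  unfolding perron_value_def bottleneck_matrix_T
proof (rule spectral_radius_le_row_sum[where n = "Suc n"])
  fix i assume "i < Suc n"
  then have "(\<Sum>j<Suc n. real (bottleneck_entry T 0 i j)) \<le> real B"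
    using assms[of i] by (simp only: lessThan_Suc_atMost of_nat_sum[symmetric] of_nat_le_iff less_Suc_eq_le)
  with \<open>i < Suc n\<close> show "(\<Sum>j<Suc n. cmod (map_mat complex_of_real
      (mat (Suc n) (Suc n) (\<lambda>(i, j). real (bottleneck_entry T 0 i j))) $$ (i, j))) \<le> real B"
    by (simp add: less_Suc_eq_le del: sum.lessThan_Suc)
qed auto

lemma perron_value_T_nonneg: "0 \<le> perron_value T 0"
proof -
  have "perron_value T 0 \<in> norm ` spectrum (map_mat complex_of_real (bottleneck_matrix T 0))"
    unfolding perron_value_def bottleneck_matrix_T
    by (rule spectral_radius_mem_max(1)[where n = "Suc n"]) auto
  then show ?thesis by auto
qed

end

section \<open>Spiders\<close>

text \<open>
  Apart from the root \<open>0\<close>, the vertices of a leg are the numbers between \<open>1\<close> and \<open>L * L\<close> in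
  one residue class modulo \<open>L\<close>, and a step towards the root subtracts \<open>L\<close>.  Truncated
  subtraction makes the root the parent of the innermost vertices \<open>1, \<dots>, L\<close>.
\<close>

locale spider =
  fixes L :: nat
  assumes L_pos: "0 < L"
begin

sublocale parent_tree "\<lambda>v. v - L" "L * L"
  by unfold_locales (use L_pos in simp)

lemma dist_ge: "v \<le> L * L \<Longrightarrow> v \<le> L * tree_dist T v 0"
proof (induction v rule: less_induct)
  case (less v)
  show ?case
  proof (cases "v = 0")
    case False
    then have "v - L \<le> L * tree_dist T (v - L) 0"
      using less L_pos by simp
    with False less.prems show ?thesis by (simp add: tree_dist_step)
  qed simp
qed

lemma dist_le: "v \<le> L * k \<Longrightarrow> k \<le> L \<Longrightarrow> tree_dist T v 0 \<le> k"
proof (induction k arbitrary: v)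
  case (Suc k)
  show ?case
  proof (cases "v = 0")
    case False
    have "v - L \<le> L * k" using Suc.prems by simp
    moreover have "v \<le> L * L" using Suc.prems by (meson le_trans mult_le_mono2)
    ultimately show ?thesis using Suc False by (simp add: tree_dist_step)
  qed simp
qed simp

text \<open>
  The path from a vertex to the root stays on the leg of that vertex.  The root has to be
  inserted separately, as it is common to all legs.
\<close>

lemma path_vertices_subset:
  "v \<le> L * L \<Longrightarrow> path_vertices T v 0 \<subseteq> insert 0 {w. w mod L = v mod L}"
proof (induction v rule: less_induct)
  case (less v)
  show ?case
  proof (cases "v = 0")
    case False
    then have IH: "path_vertices T (v - L) 0 \<subseteq> insert 0 {w. w mod L = (v - L) mod L}"
      using less L_pos by simp
    show ?thesis
    proof (cases "L \<le> v")
      case True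
      with IH less.prems False show ?thesis by (auto simp: path_vertices_step le_mod_geq)
    next
      case False
      with \<open>v \<noteq> 0\<close> less.prems show ?thesis by (simp add: path_vertices_step)
    qed
  qed simp
qed

lemma bottleneck_entry_le:
  assumes "i \<le> L * L" "j \<le> L * L"
  shows "bottleneck_entry T 0 i j \<le> 1 + (if j mod L = i mod L then L else 0)"
proof (cases "j mod L = i mod L")
  case True
  have "card (path_vertices T i 0 \<inter> path_vertices T j 0) \<le> card (path_vertices T i 0)"
    by (rule card_mono) (auto simp: path_vertices_def)
  also have "\<dots> \<le> Suc L"
    using card_path_vertices_le[of i] dist_le[of i L] assms(1) by simp
  finally show ?thesis using True by (simp add: bottleneck_entry_def)
next
  case False
  then have "path_vertices T i 0 \<inter> path_vertices T j 0 \<subseteq> {0}"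
    using path_vertices_subset[OF assms(1)] path_vertices_subset[OF assms(2)] by fastforce
  then have "card (path_vertices T i 0 \<inter> path_vertices T j 0) \<le> card {0::nat}"
    by (intro card_mono) auto
  with False show ?thesis by (simp add: bottleneck_entry_def)
qed

lemma card_residue_class_le: "card {j. j \<le> L * L \<and> j mod L = r} \<le> Suc L"
proof -
  have "{j. j \<le> L * L \<and> j mod L = r} \<subseteq> (\<lambda>q. L * q + r) ` {..L}"
  proof
    fix j assume "j \<in> {j. j \<le> L * L \<and> j mod L = r}"
    then show "j \<in> (\<lambda>q. L * q + r) ` {..L}"
      using L_pos by (intro image_eqI[of _ _ "j div L"]) (auto intro: div_le_mono[of j "L * L" L, simplified])
  qed
  then have "card {j. j \<le> L * L \<and> j mod L = r} \<le> card ((\<lambda>q. L * q + r) ` {..L})"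
    by (intro card_mono) auto
  also have "\<dots> \<le> Suc L" using card_image_le[of "{..L}" "\<lambda>q. L * q + r"] by simp
  finally show ?thesis .
qed

lemma perron_value_le: "perron_value T 0 \<le> 4 * real L ^ 2"
proof -
  have "perron_value T 0 \<le> real (4 * (L * L))"
  proof (rule perron_value_T_le)
    fix i assume i: "i \<le> L * L"
    have "(\<Sum>j\<le>L * L. bottleneck_entry T 0 i j)
        \<le> (\<Sum>j\<le>L * L. 1 + (if j mod L = i mod L then L else 0))"
      by (intro sum_mono bottleneck_entry_le i) simp
    also have "\<dots> = Suc (L * L) + (\<Sum>j\<in>{..L * L} \<inter> {j. j mod L = i mod L}. L)"
      unfolding sum.distrib by (simp add: sum.If_cases)
    also have "{..L * L} \<inter> {j. j mod L = i mod L} = {j. j \<le> L * L \<and> j mod L = i mod L}"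
      by auto
    also have "Suc (L * L) + (\<Sum>j\<in>\<dots>. L)
        = Suc (L * L) + L * card {j. j \<le> L * L \<and> j mod L = i mod L}"
      by simp
    also have "\<dots> \<le> Suc (L * L) + L * Suc L"
      by (intro add_left_mono mult_le_mono2 card_residue_class_le)
    also have "\<dots> \<le> 4 * (L * L)"
    proof -
      have "1 \<le> L * L" "L \<le> L * L" using L_pos by (auto simp: Suc_le_eq)
      then show ?thesis unfolding mult_Suc_right by linarith
    qed
    finally show "(\<Sum>j\<le>L * L. bottleneck_entry T 0 i j) \<le> 4 * (L * L)" .
  qed
  then show ?thesis by (simp add: power2_eq_square)
qed

lemma moment_gt: "real L ^ 3 / 2 < real (moment T 0)"
proof -
  have "L * L * (L * L + 1) = 2 * (\<Sum>v\<in>{0..L * L}. v)"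
    by (simp add: gauss_sum_nat)
  also have "(\<Sum>v\<in>{0..L * L}. v) \<le> (\<Sum>v\<in>{0..L * L}. L * tree_dist T v 0)"
    by (intro sum_mono dist_ge) simp
  also have "\<dots> \<le> L * moment T 0"
    using sum_tree_dist_le_moment by (simp add: sum_distrib_left[symmetric])
  finally have "L * (L * (L * L + 1)) \<le> L * (2 * moment T 0)"
    by (simp only: mult.assoc mult.left_commute[of 2 L])
  then have "L * (L * L + 1) \<le> 2 * moment T 0"
    using L_pos by (simp only: nat_mult_le_cancel1)
  then have "L * L * L < 2 * moment T 0" using L_pos by (simp add: algebra_simps)
  then have "real (L * L * L) < real (2 * moment T 0)" by (simp only: of_nat_less_iff)
  then show ?thesis by (simp add: power3_eq_cube)
qed

end

theorem theorem5p6: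
  fixes \<alpha> :: real
  shows "\<exists>(T :: nat pair_pre_digraph) r.
           rooted_tree T r \<and> real (moment T r) > \<alpha> * perron_value T r"
proof -
  \<comment> \<open>The ratio of moment and Perron value exceeds \<open>L / 8\<close>; the summand \<open>1\<close> makes \<open>L\<close> positive.\<close>
  obtain L :: nat where L: "8 * \<bar>\<alpha>\<bar> + 1 \<le> real L"
    using real_arch_simple by blast
  then have "0 < L" by (cases L) auto
  then interpret spider L by unfold_locales
  have "\<alpha> * perron_value T 0 \<le> \<bar>\<alpha>\<bar> * perron_value T 0"
    by (intro mult_right_mono perron_value_T_nonneg) simp
  also have "\<dots> \<le> \<bar>\<alpha>\<bar> * (4 * real L ^ 2)"
    by (intro mult_left_mono perron_value_le) simp
  also have "\<dots> = (8 * \<bar>\<alpha>\<bar>) * (real L ^ 2 / 2)" by simp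
  also have "\<dots> \<le> real L * (real L ^ 2 / 2)"
    using L by (intro mult_right_mono) auto
  also have "\<dots> = real L ^ 3 / 2" by (simp add: power2_eq_square power3_eq_cube)
  also have "\<dots> < real (moment T 0)" by (rule moment_gt)
  finally show ?thesis using rooted_tree_T by blast
qed

end
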